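(* Let $\omega\in A_{1}$ be a weight on $\mathbb{R}^n$ and let $0<r<1$. Then ${\rm BMO}(\omega)={\rm BMO}^{r}(\omega)$ with equivalence of the corresponding norms; that is, the two sets of functions coincide and there is a constant $C\ge 1$ such that $C^{-1}\|f\|_{{\rm BMO}(\omega)}\le \|f\|_{{\rm BMO}^{r}(\omega)}\le C\|f\|_{{\rm BMO}(\omega)}$ for all such $f$.
   Context: Cubes $Q\subset\mathbb{R}^n$ have sides parallel to the axes; $\omega(Q)=\int_Q\omega(x)\,dx$ and $f_Q=\frac{1}{|Q|}\int_Q f(x)\,dx$. A nonnegative locally integrable function $\omega$ on $\mathbb{R}^n$ belongs to $A_1$ if $[\omega]_{A_1}:=\sup_Q \left(\frac{1}{|Q|}\int_Q\omega(x)\,dx\right)\operatorname{ess\,sup}_{x\in Q}\omega(x)^{-1}<\infty$. For $0<p<\infty$, ${\rm BMO}^p(\omega)$ is the set of $f\in L^1_{\rm loc}(\mathbb{R}^n)$ with $$\|f\|_{{\rm BMO}^{p}(\omega)}=\sup_{Q}\left(\frac{1}{\omega(Q)}\int_{Q}|f(y)-f_{Q}|^{p}\omega(y)^{1-p}\,dy\right)^{1/p}<\infty,$$ and ${\rm BMO}(\omega)={\rm BMO}^1(\omega)$. *)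

theory Defs
  imports "HOL-Probability.Essential_Supremum"
begin

text \<open>Nondegenerate closed cubes with sides parallel to the axes; \<open>vec l\<close> is the vector all of whose
  coordinates are \<open>l\<close>.\<close>

definition cubes :: "(real^'n) set set" where
  "cubes = {cbox a (a + vec l) |a l. 0 < l}"

definition locally_integrable :: "(real^'n \<Rightarrow> 'b::euclidean_space) \<Rightarrow> bool" where
  "locally_integrable f \<longleftrightarrow> (\<forall>K. compact K \<longrightarrow> set_integrable lebesgue K f)"

definition avg :: "(real^'n \<Rightarrow> 'b::euclidean_space) \<Rightarrow> (real^'n) set \<Rightarrow> 'b" where
  "avg f Q = (1 / measure lebesgue Q) *\<^sub>R (LINT x:Q|lebesgue. f x)"

text \<open>A weight is not almost everywhere zero. This matters because \<open>0 * \<infinity> = 0\<close> in \<^typ>\<open>ennreal\<close>, so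
  that the zero function would otherwise satisfy the \<open>A\<^sub>1\<close> condition below.\<close>

definition weight :: "(real^'n \<Rightarrow> real) \<Rightarrow> bool" where
  "weight \<omega> \<longleftrightarrow> (\<forall>x. 0 \<le> \<omega> x) \<and> locally_integrable \<omega> \<and> \<not> (AE x in lebesgue. \<omega> x = 0)"

text \<open>\<open>\<omega>(x)\<^sup>-\<^sup>1\<close> is taken in \<^typ>\<open>ennreal\<close>, so that it is \<open>\<infinity>\<close> where \<open>\<omega>\<close> vanishes.\<close>

definition A1_const :: "(real^'n \<Rightarrow> real) \<Rightarrow> ennreal" where
  "A1_const \<omega> =
    (SUP Q\<in>cubes. ennreal (avg \<omega> Q) * esssup (lebesgue_on Q) (\<lambda>x. inverse (ennreal (\<omega> x))))"

definition A1 :: "(real^'n \<Rightarrow> real) set" where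
  "A1 = {\<omega>. weight \<omega> \<and> A1_const \<omega> < \<infinity>}"

text \<open>Powers of extended nonnegative reals, used only for exponents \<open>a > 0\<close>.\<close>

definition ennpowr :: "ennreal \<Rightarrow> real \<Rightarrow> ennreal" where
  "ennpowr x a = (if x = \<infinity> then \<infinity> else ennreal (enn2real x powr a))"

text \<open>Since \<open>0 powr a = 0\<close> for every \<open>a\<close>, the integrand is zero where \<open>\<omega>\<close> vanishes, even if
  \<open>p \<ge> 1\<close>. This is immaterial for \<open>\<omega> \<in> A1\<close>, as such \<open>\<omega>\<close> are positive almost everywhere.\<close>

definition BMO_norm :: "real \<Rightarrow> (real^'n \<Rightarrow> real) \<Rightarrow> (real^'n \<Rightarrow> 'b::euclidean_space) \<Rightarrow> ennreal" where
  "BMO_norm p \<omega> f =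
    (SUP Q\<in>cubes. ennpowr
      ((\<integral>\<^sup>+y\<in>Q. ennreal (norm (f y - avg f Q) powr p * \<omega> y powr (1 - p)) \<partial>lebesgue)
         / ennreal (LINT x:Q|lebesgue. \<omega> x))
      (1 / p))"

definition BMOp :: "real \<Rightarrow> (real^'n \<Rightarrow> real) \<Rightarrow> (real^'n \<Rightarrow> 'b::euclidean_space) set" where
  "BMOp p \<omega> = {f. locally_integrable f \<and> BMO_norm p \<omega> f < \<infinity>}"

abbreviation BMO :: "(real^'n \<Rightarrow> real) \<Rightarrow> (real^'n \<Rightarrow> 'b::euclidean_space) set" where
  "BMO \<omega> \<equiv> BMOp 1 \<omega>"

end

(* For r < 1, Hoelder's inequality (in the form of Young's) gives norm_r <= norm_1. Conversely, the
   A_1 condition bounds the weight from below on a cube Q by a multiple of its mean, so finiteness of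
   norm_r yields the weak-type bound |{x in Q : |f - f_Q| > L w_Q}| <= d |Q| with d as small as we
   like. A Calderon-Zygmund stopping argument on the dyadic subcubes of Q then gives
   X <= 2 L + (1 - c/2) X for the best constant X in int_Q |f - f_Q| <= X w(Q): the stopped cubes
   occupy at most half of Q, and the A_1 condition on their complement shows that they carry at most
   the fraction 1 - c/2 of w(Q). To avoid assuming X finite, the argument is run down to generation k
   only, with the sum of the oscillations over the k-th generation as error term; the latter tends
   to 0 because continuous functions are dense in L^1. *)
theory Submission
  imports Defs
begin

subsection \<open>Dyadic subdivision and mean oscillation\<close>

text \<open>The cubes are taken half-open so that a cube is exactly the disjoint union of its dyadic
  children; they differ from the closed cubes by null sets.\<close>

definition hcube :: "real^'n \<Rightarrow> real \<Rightarrow> (real^'n) set" where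
  "hcube a l = {x. \<forall>i. a $ i \<le> x $ i \<and> x $ i < a $ i + l}"

text \<open>\<open>B\<close> is the set of coordinates in which the child takes the upper half. The
  2^n children are thus indexed by the type \<open>'n set\<close>, and the value is the lower corner
  of one of them.\<close>

definition child :: "real^'n \<Rightarrow> real \<Rightarrow> 'n set \<Rightarrow> real^'n" where
  "child a l B = a + (\<chi> i. if i \<in> B then l / 2 else 0)"

lemma hcube_subset_cbox: "hcube a l \<subseteq> cbox a (a + vec l)"
  by (simp add: hcube_def mem_box_cart subset_iff less_imp_le)

lemma box_subset_hcube: "box a (a + vec l) \<subseteq> hcube a l"
  by (auto simp: hcube_def mem_box_cart intro: less_imp_le)

lemma hcube_borel [measurable]: "hcube a l \<in> sets borel"
proof -
  have "hcube a l = (\<Inter>i. {x. a $ i \<le> x $ i} \<inter> {x. x $ i < a $ i + l})"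
    by (auto simp: hcube_def)
  also have "\<dots> \<in> sets borel"
    by (intro sets.countable_INT'' sets.Int borel_closed borel_open
        closed_Collect_le open_Collect_less continuous_intros) auto
  finally show ?thesis .
qed

lemma hcube_lebesgue [measurable]: "hcube a l \<in> sets lebesgue"
  using hcube_borel by auto

lemma negligible_cbox_diff_hcube: "cbox a (a + vec l) - hcube a l \<in> null_sets lebesgue"
proof -
  have "negligible (cbox a (a + vec l) - box a (a + vec l))"
    by (simp add: negligible_frontier_interval)
  then have "negligible (cbox a (a + vec l) - hcube a l)"
    by (rule negligible_subset) (use box_subset_hcube in blast)
  then show ?thesis by (simp add: negligible_iff_null_sets)
qed

lemma AE_cbox_iff_hcube: "AE x in lebesgue. x \<in> cbox a (a + vec l) \<longleftrightarrow> x \<in> hcube a l"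
  by (rule AE_I'[OF negligible_cbox_diff_hcube[of a l]]) (use hcube_subset_cbox in blast)

lemma emeasure_hcube:
  assumes "0 \<le> l"
  shows "emeasure lborel (hcube (a::real^'n) l) = ennreal (l ^ CARD('n))"
proof -
  have "emeasure lebesgue (hcube a l) = emeasure lebesgue (cbox a (a + vec l))"
    using AE_cbox_iff_hcube[of a l] by (intro emeasure_eq_AE) auto
  then have "emeasure lborel (hcube a l) = emeasure lborel (cbox a (a + vec l))"
    by simp
  also have "\<dots> = ennreal (measure lborel (cbox a (a + vec l)))"
    by (intro emeasure_eq_ennreal_measure) (simp add: emeasure_lborel_cbox_eq)
  also have "measure lborel (cbox a (a + vec l)) = l ^ CARD('n)"
    using assms by (subst content_cbox_cart) (auto simp: interval_ne_empty_cart)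
  finally show ?thesis .
qed

lemma content_hcube: "0 \<le> l \<Longrightarrow> measure lborel (hcube (a::real^'n) l) = l ^ CARD('n)"
  by (simp add: measure_def emeasure_hcube)

lemma measure_hcube: "0 \<le> l \<Longrightarrow> measure lebesgue (hcube (a::real^'n) l) = l ^ CARD('n)"
  by (simp add: content_hcube)

lemma lmeasurable_hcube: "0 \<le> l \<Longrightarrow> hcube a l \<in> lmeasurable"
  by (rule fmeasurableI) (auto simp: emeasure_hcube)

lemma hcube_split:
  assumes "0 < l"
  shows "hcube a l = (\<Union>B. hcube (child a l B) (l / 2))"
proof (intro set_eqI iffI)
  fix x assume "x \<in> hcube a l"
  then have "x \<in> hcube (child a l {i. a $ i + l / 2 \<le> x $ i}) (l / 2)"
    by (auto simp: hcube_def child_def not_le algebra_simps elim: order.strict_trans2 dest!: spec)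
  then show "x \<in> (\<Union>B. hcube (child a l B) (l / 2))" by blast
next
  fix x assume "x \<in> (\<Union>B. hcube (child a l B) (l / 2))"
  then obtain B where B: "x \<in> hcube (child a l B) (l / 2)" by blast
  have "a $ i \<le> x $ i \<and> x $ i < a $ i + l" for i
    using B[unfolded hcube_def child_def, simplified, rule_format, of i] assms
    by (auto split: if_splits)
  then show "x \<in> hcube a l"
    by (simp add: hcube_def)
qed

text \<open>Any single point of a child recovers its index: i lies in \<open>B\<close> exactly when
  the point is in the upper half of the i-th side.\<close>

lemma hcube_child_disjoint:
  assumes "B \<noteq> B'"
  shows "hcube (child a l B) (l / 2) \<inter> hcube (child a l B') (l / 2) = {}"
proof -
  obtain i where "i \<in> B \<longleftrightarrow> i \<notin> B'" using assms by blast
  moreover have "i \<in> B \<longleftrightarrow> a $ i + l / 2 \<le> x $ i" if "x \<in> hcube (child a l B) (l / 2)" for x B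
    using that[unfolded hcube_def child_def, simplified, rule_format, of i] by (auto split: if_splits)
  ultimately have "\<not> (x \<in> hcube (child a l B) (l / 2) \<and> x \<in> hcube (child a l B') (l / 2))" for x
    by blast
  then show ?thesis by blast
qed

lemma hcube_child_subset: "0 < l \<Longrightarrow> hcube (child a l B) (l / 2) \<subseteq> hcube a l"
  using hcube_split by blast

lemma set_integral_hcube_split:
  fixes f :: "real^'n \<Rightarrow> 'b::euclidean_space"
  assumes "0 < l" "set_integrable lebesgue (hcube a l) f"
  shows "(LINT x:hcube a l|lebesgue. f x) = (\<Sum>B\<in>UNIV. LINT x:hcube (child a l B) (l / 2)|lebesgue. f x)"
proof -
  have "(LINT x:(\<Union>B. hcube (child a l B) (l / 2))|lebesgue. f x) =
      (\<Sum>B\<in>UNIV. LINT x:hcube (child a l B) (l / 2)|lebesgue. f x)"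
  proof (rule set_integral_finite_Union)
    show "disjoint_family_on (\<lambda>B. hcube (child a l B) (l / 2)) UNIV"
      by (simp add: disjoint_family_on_def hcube_child_disjoint)
    show "set_integrable lebesgue (hcube (child a l B) (l / 2)) f" for B
      by (rule set_integrable_subset[OF assms(2)]) (use hcube_child_subset assms in auto)
  qed auto
  then show ?thesis using hcube_split[OF assms(1)] by metis
qed

section \<open>Oscillation integrals and their sums over dyadic generations\<close>

definition oscint :: "(real^'n \<Rightarrow> 'b::euclidean_space) \<Rightarrow> (real^'n) set \<Rightarrow> real" where
  "oscint f S = (LINT x:S|lebesgue. norm (f x - avg f S))"

text \<open>If E_k f denotes the function equal to the mean of f on each cube of the k-th
  generation, this is the integral of |f - E_k f| over the initial cube. It is the error term of the
  stopping argument.\<close>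

fun dosc :: "nat \<Rightarrow> (real^'n \<Rightarrow> 'b::euclidean_space) \<Rightarrow> real^'n \<Rightarrow> real \<Rightarrow> real" where
  "dosc 0 f a l = oscint f (hcube a l)"
| "dosc (Suc k) f a l = (\<Sum>B\<in>UNIV. dosc k f (child a l B) (l / 2))"

lemma set_integrable_const:
  "S \<in> lmeasurable \<Longrightarrow> set_integrable lebesgue S (\<lambda>x. c::'b::euclidean_space)"
  unfolding set_integrable_def by (intro integrable_scaleR_left) (auto simp: fmeasurable_def)

lemma set_integral_const_lmeasurable:
  "S \<in> lmeasurable \<Longrightarrow> (LINT x:S|lebesgue. c::'b::euclidean_space) = measure lebesgue S *\<^sub>R c"
  unfolding set_lebesgue_integral_def by (auto simp: fmeasurable_def)

lemma set_integrable_norm_diff_const: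
  fixes f :: "real^'n \<Rightarrow> 'b::euclidean_space"
  assumes "S \<in> lmeasurable" "set_integrable lebesgue S f"
  shows "set_integrable lebesgue S (\<lambda>x. norm (f x - c))"
  by (intro set_integrable_norm set_integral_diff assms set_integrable_const)

lemma norm_avg_diff_le:
  fixes f g :: "real^'n \<Rightarrow> 'b::euclidean_space"
  assumes "S \<in> lmeasurable" "set_integrable lebesgue S f" "set_integrable lebesgue S g"
  shows "measure lebesgue S * norm (avg g S - avg f S) \<le> (LINT x:S|lebesgue. norm (f x - g x))"
proof (cases "measure lebesgue S = 0")
  case True
  then show ?thesis
    by (auto simp: set_lebesgue_integral_def intro!: integral_nonneg_AE)
next
  case False
  then have m: "0 < measure lebesgue S" by (simp add: zero_less_measure_iff)
  have "measure lebesgue S *\<^sub>R (avg g S - avg f S) = (LINT x:S|lebesgue. g x - f x)"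
    using m assms unfolding avg_def by (simp add: scaleR_diff_right)
  then have "measure lebesgue S * norm (avg g S - avg f S) = norm (LINT x:S|lebesgue. g x - f x)"
    using m by (metis abs_of_pos norm_scaleR)
  also have "\<dots> \<le> (LINT x:S|lebesgue. norm (g x - f x))"
    by (intro set_integral_norm_bound set_integral_diff assms)
  finally show ?thesis by (simp add: norm_minus_commute)
qed

text \<open>One copy of the L^1 distance pays for replacing f by g pointwise, the other for
  replacing the mean of f by that of g.\<close>

lemma oscint_le:
  fixes f g :: "real^'n \<Rightarrow> 'b::euclidean_space"
  assumes S: "S \<in> lmeasurable" and f: "set_integrable lebesgue S f" and g: "set_integrable lebesgue S g"
  shows "oscint f S \<le> oscint g S + 2 * (LINT x:S|lebesgue. norm (f x - g x))"
proof -
  note i = set_integrable_norm_diff_const[OF S] set_integrable_const[OF S] 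
     set_integrable_norm[OF set_integral_diff(1)[OF f g]]
  have "oscint f S \<le> (LINT x:S|lebesgue. norm (f x - g x) + norm (g x - avg g S) + norm (avg g S - avg f S))"
    unfolding oscint_def
  proof (rule set_integral_mono)
    show "set_integrable lebesgue S (\<lambda>x. norm (f x - g x) + norm (g x - avg g S) + norm (avg g S - avg f S))"
      by (intro set_integral_add i f g)
    show "norm (f x - avg f S) \<le> norm (f x - g x) + norm (g x - avg g S) + norm (avg g S - avg f S)" for x
      by norm
  qed (intro i f)
  also have "\<dots> = (LINT x:S|lebesgue. norm (f x - g x)) + oscint g S + measure lebesgue S * norm (avg g S - avg f S)"
    using S unfolding oscint_def
    by (subst set_integral_add set_integral_add(1) i f g set_integral_const_lmeasurable; (intro set_integral_add i f g)?; simp)+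
  finally show ?thesis using norm_avg_diff_le[OF S f g] by simp
qed

lemma oscint_const_le:
  fixes f :: "real^'n \<Rightarrow> 'b::euclidean_space"
  assumes S: "S \<in> lmeasurable" and f: "set_integrable lebesgue S f"
  shows "(LINT x:S|lebesgue. norm (f x - c)) \<le> oscint f S + measure lebesgue S * norm (avg f S - c)"
proof -
  have "(LINT x:S|lebesgue. norm (f x - c)) \<le> (LINT x:S|lebesgue. norm (f x - avg f S) + norm (avg f S - c))"
  proof (rule set_integral_mono)
    show "set_integrable lebesgue S (\<lambda>x. norm (f x - avg f S) + norm (avg f S - c))"
      by (intro set_integral_add set_integrable_norm_diff_const set_integrable_const S f)
    show "norm (f x - c) \<le> norm (f x - avg f S) + norm (avg f S - c)" for x by norm
  qed (intro set_integrable_norm_diff_const S f)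
  also have "\<dots> = oscint f S + measure lebesgue S * norm (avg f S - c)"
    unfolding oscint_def using S
    by (subst set_integral_add) (auto intro!: set_integrable_norm_diff_const set_integrable_const f simp: set_integral_const_lmeasurable)
  finally show ?thesis .
qed

text \<open>The error is additive over the children, so it does not grow with the generation. This
  uniformity in k is what makes an approximation of f by a continuous g useful.\<close>

lemma dosc_le:
  fixes f g :: "real^'n \<Rightarrow> 'b::euclidean_space"
  assumes "0 < l" "set_integrable lebesgue (hcube a l) f" "set_integrable lebesgue (hcube a l) g"
  shows "dosc k f a l \<le> dosc k g a l + 2 * (LINT x:hcube a l|lebesgue. norm (f x - g x))"
  using assms
proof (induction k arbitrary: a l)
  case 0
  then show ?case by (simp add: oscint_le lmeasurable_hcube)
next
  case (Suc k)
  have sub: "set_integrable lebesgue (hcube (child a l B) (l / 2)) h"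
    if "set_integrable lebesgue (hcube a l) h" for B and h :: "real^'n \<Rightarrow> 'b"
    by (rule set_integrable_subset[OF that]) (use hcube_child_subset Suc.prems in auto)
  have "dosc (Suc k) f a l \<le> (\<Sum>B\<in>UNIV. dosc k g (child a l B) (l / 2)
      + 2 * (LINT x:hcube (child a l B) (l / 2)|lebesgue. norm (f x - g x)))"
    unfolding dosc.simps by (intro sum_mono Suc.IH sub Suc.prems) (use Suc.prems in auto)
  also have "\<dots> = dosc (Suc k) g a l + 2 * (LINT x:hcube a l|lebesgue. norm (f x - g x))"
    using Suc.prems
    by (subst set_integral_hcube_split)
      (auto simp: sum.distrib sum_distrib_left intro!: set_integrable_norm)
  finally show ?case .
qed

text \<open>A cube of the k-th generation has side l / 2^k, so on it g differs from its value at the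
  corner by at most e. The third assumption speaks of pairs in the whole cube so that the children
  inherit it, with (l/2) / 2^k = l / 2^(k+1).\<close>

lemma dosc_uniform_bound:
  fixes g :: "real^'n \<Rightarrow> 'b::euclidean_space"
  assumes "0 < l" "set_integrable lebesgue (hcube a l) g"
    and "\<And>x y. x \<in> hcube a l \<Longrightarrow> y \<in> hcube a l \<Longrightarrow> (\<And>i. \<bar>x $ i - y $ i\<bar> \<le> l / 2 ^ k) \<Longrightarrow> norm (g x - g y) \<le> e"
  shows "dosc k g a l \<le> 2 * e * l ^ CARD('n)"
  using assms
proof (induction k arbitrary: a l)
  case 0
  let ?S = "hcube a l"
  have S: "?S \<in> lmeasurable" using 0 by (simp add: lmeasurable_hcube)
  have m: "measure lebesgue ?S = l ^ CARD('n)" using 0 by (intro measure_hcube) simp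
  have a: "a \<in> ?S" using 0 by (simp add: hcube_def)
  have b: "norm (g x - g a) \<le> e" if "x \<in> ?S" for x
  proof (rule 0(3)[OF that a])
    show "\<bar>x $ i - a $ i\<bar> \<le> l / 2 ^ 0" for i
      using that[unfolded hcube_def, simplified, rule_format, of i] by auto
  qed
  \<comment> \<open>The comparison function is the constant value at the lower corner, which has
    oscillation 0; the factor 2 of the bound arises here.\<close>
  have "oscint g ?S \<le> oscint (\<lambda>_. g a) ?S + 2 * (LINT x:?S|lebesgue. norm (g x - g a))"
    by (intro oscint_le S 0 set_integrable_const)
  also have "oscint (\<lambda>_. g a) ?S = 0"
    using 0(1) S m by (simp add: oscint_def avg_def set_integral_const_lmeasurable)
  also have "(LINT x:?S|lebesgue. norm (g x - g a)) \<le> (LINT x:?S|lebesgue. e)"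
    by (intro set_integral_mono set_integrable_norm_diff_const S 0 set_integrable_const b)
  also have "\<dots> = e * l ^ CARD('n)"
    using S m by (simp add: set_integral_const_lmeasurable)
  finally show ?case by simp
next
  case (Suc k)
  have "dosc (Suc k) g a l \<le> (\<Sum>B\<in>(UNIV::'n set set). 2 * e * (l / 2) ^ CARD('n))"
    unfolding dosc.simps
  proof (intro sum_mono Suc.IH)
    fix B :: "'n set"
    show "set_integrable lebesgue (hcube (child a l B) (l / 2)) g"
      by (rule set_integrable_subset[OF Suc.prems(2)]) (use hcube_child_subset Suc.prems in auto)
    show "norm (g x - g y) \<le> e" if "x \<in> hcube (child a l B) (l / 2)" "y \<in> hcube (child a l B) (l / 2)"
      "\<And>i. \<bar>x $ i - y $ i\<bar> \<le> l / 2 / 2 ^ k" for x y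
      using that hcube_child_subset[OF Suc.prems(1), of a B] by (intro Suc.prems(3)) auto
  qed (use Suc.prems in auto)
  \<comment> \<open>Each of the 2^n children has 2^-n of the volume.\<close>
  also have "\<dots> = 2 * e * l ^ CARD('n)"
    by (simp add: card_UNIV_set power_divide)
  finally show ?case .
qed

subsection \<open>Density of continuous functions\<close>

text \<open>S is squeezed between a closed T and an open U. A Urysohn function that is 1 on T and 0
  off U agrees with the indicator of S outside the small set U - T.\<close>

lemma indicator_L1_approx_continuous:
  fixes S :: "'a::euclidean_space set"
  assumes S: "S \<in> sets lebesgue" and K: "K = cbox a b" and e: "0 < e"
  shows "\<exists>g::'a \<Rightarrow> real. continuous_on UNIV g \<and> (LINT x:K|lebesgue. \<bar>indicator S x - g x\<bar>) \<le> e"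
proof -
  obtain U where U: "open U" "S \<subseteq> U" "U - S \<in> lmeasurable" "emeasure lebesgue (U - S) < ennreal (e/2)"
    using sets_lebesgue_outer_open[OF S, of "e/2"] e by auto
  obtain T where T: "closed T" "T \<subseteq> S" "S - T \<in> lmeasurable" "emeasure lebesgue (S - T) < ennreal (e/2)"
    using sets_lebesgue_inner_closed[OF S, of "e/2"] e by auto
  obtain g :: "'a \<Rightarrow> real" where g: "continuous_on UNIV g" "\<And>x. g x \<in> closed_segment 0 1"
    "\<And>x. x \<in> - U \<Longrightarrow> g x = 0" "\<And>x. x \<in> T \<Longrightarrow> g x = 1"
    by (rule Urysohn[of "- U" T 0 1]) (use U T in auto)
  have g01: "0 \<le> g x" "g x \<le> 1" for x using g(2)[of x] by (auto simp: closed_segment_eq_real_ivl)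
  have D: "(U - S) \<union> (S - T) \<in> lmeasurable" by (intro fmeasurable.Un U T)
  have [measurable]: "g \<in> borel_measurable lebesgue"
    by (rule measurable_completion) (simp add: borel_measurable_continuous_onI g(1))
  note [measurable] = S fmeasurableD[OF D]
  have K': "K \<in> sets lebesgue" using K by simp
  have i: "integrable lebesgue (\<lambda>x. indicator ((U - S) \<union> (S - T)) x :: real)"
    using D by (auto simp: fmeasurable_def)
  have bd: "indicator K x *\<^sub>R \<bar>indicator S x - g x\<bar> \<le> indicator ((U - S) \<union> (S - T)) x" for x
    using g01[of x] g(3)[of x] g(4)[of x] T(2) U(2) by (auto simp: indicator_def)
  have "(LINT x:K|lebesgue. \<bar>indicator S x - g x\<bar>) \<le> (LINT x|lebesgue. indicator ((U - S) \<union> (S - T)) x)"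
    unfolding set_lebesgue_integral_def
  proof (rule integral_mono[OF _ i])
    show "integrable lebesgue (\<lambda>x. indicator K x *\<^sub>R \<bar>indicator S x - g x\<bar>)"
      using bd K' by (intro Bochner_Integration.integrable_bound[OF i]) auto
  qed (rule bd)
  also have "\<dots> = measure lebesgue ((U - S) \<union> (S - T))" using D by simp
  also have "\<dots> \<le> measure lebesgue (U - S) + measure lebesgue (S - T)"
    using U T by (intro measure_Un_le) auto
  also have "\<dots> \<le> e / 2 + e / 2"
  proof (rule add_mono)
    show "measure lebesgue (U - S) \<le> e / 2" "measure lebesgue (S - T) \<le> e / 2"
      using U(3,4) T(3,4) e by (auto simp: emeasure_eq_measure2 ennreal_less_iff)
  qed
  finally show ?thesis using g(1) by auto
qed

text \<open>Closeness is demanded on a compact box only, so g need not be integrable over the whole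
  space. The induction runs through scaled indicators, sums and dominated limits.\<close>

lemma integrable_L1_approx_continuous:
  fixes f :: "'a::euclidean_space \<Rightarrow> 'b::euclidean_space"
  assumes f: "integrable lebesgue f" and K: "K = cbox a b" and e: "0 < e"
  shows "\<exists>g. continuous_on UNIV g \<and> (LINT x:K|lebesgue. norm (f x - g x)) \<le> e"
  using f e
proof (induction arbitrary: e rule: integrable_induct)
  case (base S c)
  \<comment> \<open>Adding 1 to the norm of c covers the case c = 0.\<close>
  obtain g where g: "continuous_on UNIV g" "(LINT x:K|lebesgue. \<bar>indicator S x - g x\<bar>) \<le> e / (norm c + 1)"
    using indicator_L1_approx_continuous[OF base(1) K, of "e / (norm c + 1)"] base(3)
    by (metis add_nonneg_pos divide_pos_pos norm_ge_zero zero_less_one)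
  have "norm (indicator S x *\<^sub>R c - g x *\<^sub>R c) = \<bar>indicator S x - g x\<bar> * norm c" for x
    by (metis norm_scaleR scaleR_diff_left)
  then have "(LINT x:K|lebesgue. norm (indicator S x *\<^sub>R c - g x *\<^sub>R c))
      = (LINT x:K|lebesgue. \<bar>indicator S x - g x\<bar>) * norm c" by simp
  also have "\<dots> \<le> e / (norm c + 1) * norm c"
    by (intro mult_right_mono g) auto
  also have "\<dots> \<le> e" using base(3) mult_left_mono[of "norm c / (norm c + 1)" 1 e] by (simp add: divide_le_eq_1 add_nonneg_pos)
  finally show ?case
    using g(1) by (intro exI[of _ "\<lambda>x. g x *\<^sub>R c"]) (auto intro!: continuous_intros)
next
  case (add f1 f2)
  obtain g1 g2 where g: "continuous_on UNIV g1" "(LINT x:K|lebesgue. norm (f1 x - g1 x)) \<le> e / 2"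
    "continuous_on UNIV g2" "(LINT x:K|lebesgue. norm (f2 x - g2 x)) \<le> e / 2"
    using add.IH(1)[of "e / 2"] add.IH(2)[of "e / 2"] \<open>0 < e\<close> by auto
  have gi: "set_integrable lebesgue K g1" "set_integrable lebesgue K g2"
    unfolding K by (auto intro!: absolutely_integrable_continuous intro: continuous_on_subset[OF g(1)] continuous_on_subset[OF g(3)])
  have fi: "set_integrable lebesgue K f1" "set_integrable lebesgue K f2"
    using add(1,2) K unfolding set_integrable_def
    by (auto intro!: integrable_mult_indicator)
  note i = set_integrable_norm[OF set_integral_diff(1)[OF fi(1) gi(1)]]
    set_integrable_norm[OF set_integral_diff(1)[OF fi(2) gi(2)]]
  have "(LINT x:K|lebesgue. norm (f1 x + f2 x - (g1 x + g2 x)))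
     \<le> (LINT x:K|lebesgue. norm (f1 x - g1 x) + norm (f2 x - g2 x))"
    by (intro set_integral_mono set_integrable_norm set_integral_diff set_integral_add i fi gi)
      norm
  also have "\<dots> = (LINT x:K|lebesgue. norm (f1 x - g1 x)) + (LINT x:K|lebesgue. norm (f2 x - g2 x))"
    by (rule set_integral_add(2)[OF i])
  also have "\<dots> \<le> e" using g by simp
  finally show ?case
    using g by (intro exI[of _ "\<lambda>x. g1 x + g2 x"]) (auto intro!: continuous_intros)
next
  case (lim f s)
  have "(\<lambda>i. LINT x|lebesgue. norm (f x - s i x)) \<longlonglongrightarrow> (LINT x|(lebesgue::'a measure). 0)"
  proof (rule integral_dominated_convergence)
    \<comment> \<open>The approximants satisfy |s_i| <= 2 |f|, whence the dominating function 3
      |f|.\<close>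
    show "integrable lebesgue (\<lambda>x. 3 * norm (f x))" using lim by auto
    show "AE x in lebesgue. norm (norm (f x - s i x)) \<le> 3 * norm (f x)" for i
    proof (rule AE_I2)
      fix x :: 'a assume "x \<in> space lebesgue"
      with lim(3) have "norm (s i x) \<le> 2 * norm (f x)" by blast
      with norm_triangle_ineq4[of "f x" "s i x"] show "norm (norm (f x - s i x)) \<le> 3 * norm (f x)" by simp
    qed
    show "AE x in lebesgue. (\<lambda>i. norm (f x - s i x)) \<longlonglongrightarrow> 0"
    proof (rule AE_I2)
      fix x :: 'a assume "x \<in> space lebesgue"
      with lim(2) have "(\<lambda>i. s i x) \<longlonglongrightarrow> f x" by blast
      from tendsto_norm[OF tendsto_diff[OF tendsto_const[of "f x"] this]]
      show "(\<lambda>i. norm (f x - s i x)) \<longlonglongrightarrow> 0" by simp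
    qed
  qed (use lim in \<open>auto intro: borel_measurable_integrable\<close>)
  then have "(\<lambda>i. LINT x|lebesgue. norm (f x - s i x)) \<longlonglongrightarrow> 0" by simp
  then have "eventually (\<lambda>i. (LINT x|lebesgue. norm (f x - s i x)) < e / 2) sequentially"
    using \<open>0 < e\<close> by (intro order_tendstoD) auto
  then obtain i where i: "(LINT x|lebesgue. norm (f x - s i x)) < e / 2"
    by (meson eventually_happens trivial_limit_sequentially)
  obtain g where g: "continuous_on UNIV g" "(LINT x:K|lebesgue. norm (s i x - g x)) \<le> e / 2"
    using lim.IH[of "e / 2" i] \<open>0 < e\<close> by auto
  have K': "K \<in> sets lebesgue" using K by simp
  have gi: "set_integrable lebesgue K g"
    unfolding K by (intro absolutely_integrable_continuous continuous_on_subset[OF g(1)]) auto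
  have fi: "set_integrable lebesgue K f" "set_integrable lebesgue K (s i)"
    using lim(1,4) K' unfolding set_integrable_def
    by (auto intro!: integrable_mult_indicator)
  note ii = set_integrable_norm[OF set_integral_diff(1)[OF fi]]
    set_integrable_norm[OF set_integral_diff(1)[OF fi(2) gi]]
  have "(LINT x:K|lebesgue. norm (f x - g x))
     \<le> (LINT x:K|lebesgue. norm (f x - s i x) + norm (s i x - g x))"
    by (intro set_integral_mono set_integrable_norm set_integral_diff set_integral_add ii fi gi)
      norm
  also have "\<dots> = (LINT x:K|lebesgue. norm (f x - s i x)) + (LINT x:K|lebesgue. norm (s i x - g x))"
    by (rule set_integral_add(2)[OF ii])
  also have "(LINT x:K|lebesgue. norm (f x - s i x)) \<le> (LINT x|lebesgue. norm (f x - s i x))"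
    unfolding set_lebesgue_integral_def using lim(1,4) ii(1)
    by (intro integral_mono) (auto simp: set_integrable_def indicator_def)
  finally show ?case using i g by (intro exI[of _ g]) auto
qed

text \<open>Half of e pays for replacing f by a continuous g, uniformly in k; the other half pays
  for the oscillation of g, which is uniformly continuous on the closed cube.\<close>

lemma dosc_arbitrarily_small:
  fixes f :: "real^'n \<Rightarrow> 'b::euclidean_space"
  assumes f: "set_integrable lebesgue (hcube a l) f" and l: "0 < l" and e: "0 < e"
  shows "\<exists>k. dosc k f a l \<le> e"
proof -
  \<comment> \<open>f is known to be integrable only on the cube, so it is extended by zero before
    being approximated.\<close>
  let ?H = "hcube a l" and ?K = "cbox a (a + vec l)" and ?f = "\<lambda>x. indicator (hcube a l) x *\<^sub>R f x"
  obtain g where g: "continuous_on UNIV g" "(LINT x:?K|lebesgue. norm (?f x - g x)) \<le> e / 4"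
    using integrable_L1_approx_continuous[OF f[unfolded set_integrable_def] refl, of "e / 4" a "a + vec l"] e
    by (simp only: divide_pos_pos zero_less_numeral) blast
  have fK: "set_integrable lebesgue ?K ?f"
    unfolding set_integrable_def by (intro integrable_mult_indicator f[unfolded set_integrable_def]) auto
  have gK: "set_integrable lebesgue ?K g"
    by (intro absolutely_integrable_continuous continuous_on_subset[OF g(1)]) auto
  have gH: "set_integrable lebesgue ?H g"
    by (rule set_integrable_subset[OF gK]) (auto simp: hcube_subset_cbox)
  have "(LINT x:?H|lebesgue. norm (f x - g x)) \<le> (LINT x:?K|lebesgue. norm (?f x - g x))"
    unfolding set_lebesgue_integral_def
  proof (rule integral_mono)
    show "integrable lebesgue (\<lambda>x. indicator ?H x *\<^sub>R norm (f x - g x))"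
      using set_integrable_norm[OF set_integral_diff(1)[OF f gH]] by (simp add: set_integrable_def)
    show "integrable lebesgue (\<lambda>x. indicator ?K x *\<^sub>R norm (?f x - g x))"
      using set_integrable_norm[OF set_integral_diff(1)[OF fK gK]] by (simp add: set_integrable_def)
    show "indicator ?H x *\<^sub>R norm (f x - g x) \<le> indicator ?K x *\<^sub>R norm (?f x - g x)" for x
      using hcube_subset_cbox[of a l] by (auto simp: indicator_def)
  qed
  with g(2) have fg: "(LINT x:?H|lebesgue. norm (f x - g x)) \<le> e / 4" by simp
  \<comment> \<open>Chosen so that 2 d l^n = e / 2.\<close>
  define d where "d = e / (4 * l ^ CARD('n))"
  have d: "0 < d" using e l by (simp add: d_def)
  have "uniformly_continuous_on ?K g"
    using g(1) by (intro compact_uniformly_continuous) (auto intro: continuous_on_subset)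
  then obtain \<delta> where \<delta>: "0 < \<delta>" "\<And>x y. x \<in> ?K \<Longrightarrow> y \<in> ?K \<Longrightarrow> dist x y < \<delta> \<Longrightarrow> dist (g x) (g y) < d"
    using d unfolding uniformly_continuous_on_def by metis
  \<comment> \<open>Coordinate differences of at most l / 2^k give a Euclidean distance of at most n
    l / 2^k, through the l^1 norm.\<close>
  have "(\<lambda>k. real CARD('n) * (l * (1 / 2) ^ k)) \<longlonglongrightarrow> real CARD('n) * (l * 0)"
    by (intro tendsto_intros LIMSEQ_power_zero) auto
  then have "eventually (\<lambda>k. real CARD('n) * (l * (1 / 2) ^ k) < \<delta>) sequentially"
    using \<delta>(1) by (intro order_tendstoD) auto
  then obtain k where k: "real CARD('n) * (l / 2 ^ k) < \<delta>"
    by (auto simp: eventually_sequentially power_divide)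
  have "dosc k g a l \<le> 2 * d * l ^ CARD('n)"
  proof (rule dosc_uniform_bound[OF l gH])
    fix x y assume xy: "x \<in> ?H" "y \<in> ?H" "\<And>i. \<bar>x $ i - y $ i\<bar> \<le> l / 2 ^ k"
    have "norm (x - y) \<le> (\<Sum>i\<in>UNIV. \<bar>(x - y) $ i\<bar>)" by (rule norm_le_l1_cart)
    also have "\<dots> \<le> (\<Sum>i\<in>(UNIV::'n set). l / 2 ^ k)" by (intro sum_mono) (simp add: xy)
    also have "\<dots> < \<delta>" using k by simp
    finally have "dist (g x) (g y) < d"
      using xy hcube_subset_cbox[of a l] by (intro \<delta>) (auto simp: dist_norm)
    then show "norm (g x - g y) \<le> d" by (simp add: dist_norm)
  qed
  also have "\<dots> = e / 2" using l by (simp add: d_def)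
  finally have "dosc k f a l \<le> e / 2 + 2 * (e / 4)"
    using dosc_le[OF l f gH, of k] fg by simp
  then show ?thesis by (intro exI[of _ k]) simp
qed

subsection \<open>The stopping-time argument\<close>

text \<open>The weak-type constant is half of the stopping density \<open>2\<^bsup>-(n+1)\<^esup>\<close> used below. A cube below the
  stopping density has children of density at most \<open>1/2\<close>, so the mean of \<open>f\<close> over a child is still
  comparable with the mean over the initial cube, and the stopped children cover at most half of
  the initial cube.\<close>

locale weak_oscillation =
  fixes f :: "real^'n \<Rightarrow> 'b::euclidean_space" and w :: "real^'n \<Rightarrow> real" and L c :: real
  assumes f_int: "\<And>a l. 0 < l \<Longrightarrow> set_integrable lebesgue (hcube a l) f"
    and w_int: "\<And>a l. 0 < l \<Longrightarrow> set_integrable lebesgue (hcube a l) w"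
    and w_nonneg: "\<And>x. 0 \<le> w x"
    and c_pos: "0 < c" and L_nonneg: "0 \<le> L"
    and w_lower: "\<And>a l. 0 < l \<Longrightarrow> AE x in lebesgue. x \<in> hcube a l \<longrightarrow> c * avg w (hcube a l) \<le> w x"
    and weak_type: "\<And>a l. 0 < l \<Longrightarrow>
      measure lebesgue {x \<in> hcube a l. L * avg w (hcube a l) < norm (f x - avg f (hcube a l))}
        \<le> l ^ CARD('n) / 2 ^ (CARD('n) + 2)"
begin

abbreviation W :: "(real^'n) set \<Rightarrow> real" where
  "W S \<equiv> (LINT x:S|lebesgue. w x)"

lemma avg_w: "0 < l \<Longrightarrow> avg w (hcube a l) * l ^ CARD('n) = W (hcube a l)"
  by (simp add: avg_def measure_hcube content_hcube)

lemma W_nonneg: "0 \<le> W S"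
  unfolding set_lebesgue_integral_def by (intro integral_nonneg_AE) (auto simp: w_nonneg)

lemma avg_w_nonneg: "0 \<le> avg w S"
  unfolding avg_def using W_nonneg by simp

text \<open>The centre \<open>c0\<close> and the height \<open>M\<close> are free parameters because
  they stay at the values of the initial cube while the descent changes \<open>a\<close> and
  \<open>l\<close>.\<close>

definition big :: "'b \<Rightarrow> real \<Rightarrow> real^'n \<Rightarrow> real \<Rightarrow> (real^'n) set" where
  "big c0 M a l = {x \<in> hcube a l. M < norm (f x - c0)}"

lemma big_lmeasurable:
  assumes "0 < l"
  shows "big c0 M a l \<in> lmeasurable"
proof -
  have [measurable]: "(\<lambda>x. indicator (hcube a l) x *\<^sub>R f x) \<in> borel_measurable lebesgue"
    using f_int[OF assms] unfolding set_integrable_def by (rule borel_measurable_integrable)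
  have "big c0 M a l = hcube a l \<inter> {x \<in> space lebesgue. M < norm (indicator (hcube a l) x *\<^sub>R f x - c0)}"
    by (auto simp: big_def)
  also have "\<dots> \<in> sets lebesgue" by measurable
  finally have "big c0 M a l \<in> sets lebesgue" .
  then show ?thesis
    by (rule fmeasurableI2[OF lmeasurable_hcube[of l a], rotated 2]) (use assms in \<open>auto simp: big_def\<close>)
qed

lemma big_split:
  assumes "0 < l"
  shows "measure lebesgue (big c0 M a l) = (\<Sum>B\<in>UNIV. measure lebesgue (big c0 M (child a l B) (l / 2)))"
proof -
  have "big c0 M a l = (\<Union>B. big c0 M (child a l B) (l / 2))"
    using hcube_split[OF assms] by (auto simp: big_def)
  moreover have "measure lebesgue (\<Union>B. big c0 M (child a l B) (l / 2)) = (\<Sum>B\<in>UNIV. measure lebesgue (big c0 M (child a l B) (l / 2)))"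
  proof (rule measure_finite_Union)
    show "disjoint_family_on (\<lambda>B. big c0 M (child a l B) (l / 2)) UNIV"
      unfolding disjoint_family_on_def big_def using hcube_child_disjoint by blast
    show "emeasure lebesgue (big c0 M (child a l B) (l / 2)) \<noteq> \<infinity>" for B
      using big_lmeasurable[of "l / 2" c0 M "child a l B"] assms unfolding fmeasurable_def by force
    show "(\<lambda>B. big c0 M (child a l B) (l / 2)) ` UNIV \<subseteq> sets lebesgue"
      using big_lmeasurable[of "l / 2"] assms by (auto simp: fmeasurable_def)
  qed auto
  ultimately show ?thesis by simp
qed

text \<open>The points where f is far from \<open>c0\<close> and those where f is far from its own
  mean fill at most 1/2 + 1/4 of the cube. A point outside both sets compares the mean with
  \<open>c0\<close> by the triangle inequality.\<close>

lemma avg_close: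
  assumes l: "0 < l" and M: "measure lebesgue (big c0 M a l) \<le> l ^ CARD('n) / 2"
  shows "norm (avg f (hcube a l) - c0) \<le> L * avg w (hcube a l) + M"
proof -
  let ?E = "big (avg f (hcube a l)) (L * avg w (hcube a l)) a l"
  have "measure lebesgue (big c0 M a l \<union> ?E) \<le> measure lebesgue (big c0 M a l) + measure lebesgue ?E"
    using big_lmeasurable[OF l] by (intro measure_Un_le) auto
  also have "\<dots> \<le> l ^ CARD('n) / 2 + l ^ CARD('n) / 2 ^ (CARD('n) + 2)"
    using M weak_type[OF l] by (intro add_mono) (auto simp: big_def)
  also have "l ^ CARD('n) / 2 ^ (CARD('n) + 2) \<le> l ^ CARD('n) / 4"
  proof (rule divide_left_mono)
    have "(1::real) \<le> 2 ^ CARD('n)" by simp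
    then show "(4::real) \<le> 2 ^ (CARD('n) + 2)" by (simp add: power_add)
  qed (use l in auto)
  also have "l ^ CARD('n) / 2 + l ^ CARD('n) / 4 < l ^ CARD('n)" using l by simp
  also have "\<dots> = measure lebesgue (hcube a l)" using l by (intro measure_hcube[symmetric]) simp
  finally have less: "measure lebesgue (big c0 M a l \<union> ?E) < measure lebesgue (hcube a l)" by simp
  have "\<not> hcube a l \<subseteq> big c0 M a l \<union> ?E"
  proof
    assume "hcube a l \<subseteq> big c0 M a l \<union> ?E"
    then have "measure lebesgue (hcube a l) \<le> measure lebesgue (big c0 M a l \<union> ?E)"
      using big_lmeasurable[OF l] by (intro measure_mono_fmeasurable) auto
    with less show False by simp
  qed
  then obtain x where "norm (f x - c0) \<le> M" "norm (f x - avg f (hcube a l)) \<le> L * avg w (hcube a l)"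
    by (force simp: big_def not_less)
  then show ?thesis
    using norm_triangle_ineq4[of "f x - c0" "f x - avg f (hcube a l)"] by simp
qed

lemma dist_const_le:
  assumes l: "0 < l" and M: "measure lebesgue (big c0 M a l) \<le> l ^ CARD('n) / 2"
  shows "(LINT x:hcube a l|lebesgue. norm (f x - c0))
    \<le> oscint f (hcube a l) + L * W (hcube a l) + M * l ^ CARD('n)"
proof -
  have "(LINT x:hcube a l|lebesgue. norm (f x - c0))
    \<le> oscint f (hcube a l) + measure lebesgue (hcube a l) * norm (avg f (hcube a l) - c0)"
    using l by (intro oscint_const_le lmeasurable_hcube f_int) auto
  also have "measure lebesgue (hcube a l) = l ^ CARD('n)" using l by (intro measure_hcube) simp
  also have "l ^ CARD('n) * norm (avg f (hcube a l) - c0) \<le> l ^ CARD('n) * (L * avg w (hcube a l) + M)"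
    using l by (intro mult_left_mono avg_close M) auto
  also have "\<dots> = L * W (hcube a l) + M * l ^ CARD('n)"
    using l by (simp add: avg_w[symmetric] algebra_simps)
  finally show ?thesis by simp
qed

text \<open>\<open>U\<close> is the union of the stopped cubes. Descending only \<open>j\<close> generations keeps the
  family finite, at the cost of the error term \<open>dosc j f\<close> from the cubes that never stop; this
  replaces the Lebesgue differentiation theorem.\<close>

lemma stopping:
  assumes X: "0 \<le> X"
    and IH: "\<And>j a l. j < k \<Longrightarrow> 0 < l \<Longrightarrow> oscint f (hcube a l) \<le> X * W (hcube a l) + dosc j f a l"
    and "j \<le> k" "0 < l" "measure lebesgue (big c0 M a l) \<le> l ^ CARD('n) / 2 ^ (CARD('n) + 1)"
  shows "\<exists>U\<in>sets lebesgue. U \<subseteq> hcube a l \<and> measure lebesgue U \<le> 2 ^ (CARD('n) + 1) * measure lebesgue (big c0 M a l) \<and>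
    (LINT x:hcube a l|lebesgue. norm (f x - c0)) \<le> L * W (hcube a l) + M * l ^ CARD('n) + X * W U + dosc j f a l"
  using assms(3-)
\<comment> \<open>\<open>c0\<close>, \<open>M\<close> and \<open>k\<close> stay fixed; only the
  depth and the cube vary. \<open>IH\<close> is supplied by the outer induction in
  \<open>oscint_le_dosc\<close> and applies to the children, because Suc j <= k gives j < k.\<close>
proof (induction j arbitrary: a l)
  case 0
  have "l ^ CARD('n) / 2 ^ (CARD('n) + 1) \<le> l ^ CARD('n) / 2"
    using 0(2) by (intro divide_left_mono) auto
  with 0 have "(LINT x:hcube a l|lebesgue. norm (f x - c0))
    \<le> oscint f (hcube a l) + L * W (hcube a l) + M * l ^ CARD('n)"
    by (intro dist_const_le) auto
  \<comment> \<open>At depth 0 nothing is stopped, and the oscillation of the cube is itself the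
    error term \<open>dosc 0\<close>.\<close>
  then show ?case by (intro bexI[of _ "{}"]) (auto simp: set_lebesgue_integral_def)
next
  case (Suc j)
  let ?H = "\<lambda>B. hcube (child a l B) (l / 2)" and ?E = "\<lambda>B. big c0 M (child a l B) (l / 2)"
  let ?n = "CARD('n)"
  have l2: "0 < l / 2" using Suc.prems by simp
  have "\<exists>U\<in>sets lebesgue. U \<subseteq> ?H B \<and> measure lebesgue U \<le> 2 ^ (?n + 1) * measure lebesgue (?E B) \<and>
    (LINT x:?H B|lebesgue. norm (f x - c0)) \<le> L * W (?H B) + M * (l / 2) ^ ?n + X * W U + dosc j f (child a l B) (l / 2)" for B
  \<comment> \<open>A child of low density is subdivided further; any other child is stopped, and
    \<open>IH\<close> bounds its oscillation.\<close>
  proof (cases "measure lebesgue (?E B) \<le> (l / 2) ^ ?n / 2 ^ (?n + 1)")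
    case True
    then show ?thesis using Suc.prems l2 by (intro Suc.IH) auto
  next
    case False
    have "measure lebesgue (?E B) \<le> measure lebesgue (big c0 M a l)"
      using big_lmeasurable[OF Suc.prems(2)] big_lmeasurable[OF l2] hcube_child_subset[OF Suc.prems(2), of a B]
      by (intro measure_mono_fmeasurable) (auto simp: big_def)
    \<comment> \<open>The child has 2^-n of the volume of its parent, so the density bound 2^-(n+1)
      of the parent becomes 1/2 on the child.\<close>
    also have "\<dots> \<le> (l / 2) ^ ?n / 2" using Suc.prems by (simp add: power_divide)
    finally have "(LINT x:?H B|lebesgue. norm (f x - c0)) \<le> oscint f (?H B) + L * W (?H B) + M * (l / 2) ^ ?n"
      by (rule dist_const_le[OF l2])
    moreover have "oscint f (?H B) \<le> X * W (?H B) + dosc j f (child a l B) (l / 2)"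
      using Suc.prems l2 by (intro IH) auto
    \<comment> \<open>Exceeding the stopping density charges the volume of the child to the
      exceptional set inside it.\<close>
    moreover have "measure lebesgue (?H B) \<le> 2 ^ (?n + 1) * measure lebesgue (?E B)"
      using False l2 by (subst measure_hcube) (auto simp: field_simps)
    ultimately show ?thesis by (intro bexI[of _ "?H B"]) auto
  qed
  then obtain U where U: "\<And>B. U B \<in> sets lebesgue" "\<And>B. U B \<subseteq> ?H B"
    "\<And>B. measure lebesgue (U B) \<le> 2 ^ (?n + 1) * measure lebesgue (?E B)"
    "\<And>B. (LINT x:?H B|lebesgue. norm (f x - c0)) \<le> L * W (?H B) + M * (l / 2) ^ ?n + X * W (U B) + dosc j f (child a l B) (l / 2)"
    by metis
  have WU: "W (\<Union>B. U B) = (\<Sum>B\<in>UNIV. W (U B))"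
  proof (rule set_integral_finite_Union)
    show "disjoint_family_on U UNIV"
      unfolding disjoint_family_on_def using U(2) hcube_child_disjoint by blast
    show "set_integrable lebesgue (U B) w" for B
      by (rule set_integrable_subset[OF w_int[OF l2] U(1) U(2)])
  qed (use U in auto)
  have "measure lebesgue (\<Union>B. U B) \<le> (\<Sum>B\<in>UNIV. measure lebesgue (U B))"
    using U(1) by (intro measure_UNION_le) auto
  also have "\<dots> \<le> (\<Sum>B\<in>UNIV. 2 ^ (?n + 1) * measure lebesgue (?E B))"
    by (intro sum_mono U)
  also have "\<dots> = 2 ^ (?n + 1) * measure lebesgue (big c0 M a l)"
    by (simp add: big_split[OF Suc.prems(2)] sum_distrib_left)
  finally have mU: "measure lebesgue (\<Union>B. U B) \<le> 2 ^ (?n + 1) * measure lebesgue (big c0 M a l)" .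
  have fi: "set_integrable lebesgue (hcube a l) (\<lambda>x. norm (f x - c0))"
    using Suc.prems by (intro set_integrable_norm_diff_const lmeasurable_hcube f_int) auto
  have "(LINT x:hcube a l|lebesgue. norm (f x - c0)) = (\<Sum>B\<in>UNIV. LINT x:?H B|lebesgue. norm (f x - c0))"
    by (rule set_integral_hcube_split[OF Suc.prems(2) fi])
  also have "\<dots> \<le> (\<Sum>B\<in>UNIV. L * W (?H B) + M * (l / 2) ^ ?n + X * W (U B) + dosc j f (child a l B) (l / 2))"
    by (intro sum_mono U)
  \<comment> \<open>The first two terms add up exactly, as 2^n (l/2)^n = l^n, so the constants do
    not grow with the number of generations.\<close>
  also have "\<dots> = L * W (hcube a l) + M * l ^ ?n + X * W (\<Union>B. U B) + dosc (Suc j) f a l"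
    unfolding WU set_integral_hcube_split[OF Suc.prems(2) w_int[OF Suc.prems(2)]]
    by (simp add: sum.distrib sum_distrib_left card_UNIV_set power_divide)
  finally show ?case
    using mU U(1,2) hcube_split[OF Suc.prems(2), of a]
    by (intro bexI[of _ "\<Union>B. U B"] conjI) blast+
qed

text \<open>The complement of U fills at least half of the cube and w >= c w_Q almost everywhere
  there, so at least the fraction c/2 of w(Q) lies outside U.\<close>

lemma W_half_le:
  assumes l: "0 < l" and U: "U \<in> sets lebesgue" "U \<subseteq> hcube a l" "measure lebesgue U \<le> l ^ CARD('n) / 2"
  shows "W U \<le> (1 - c / 2) * W (hcube a l)"
proof -
  let ?H = "hcube a l"
  have wi: "set_integrable lebesgue U w" "set_integrable lebesgue (?H - U) w"
    using U by (auto intro!: set_integrable_subset[OF w_int[OF l, of a]])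
  have H: "?H \<in> lmeasurable" using l by (simp add: lmeasurable_hcube)
  then have Um: "U \<in> lmeasurable" using U by (auto intro: fmeasurableI2)
  have D: "?H - U \<in> lmeasurable" using H U by (intro fmeasurable_Diff) auto
  have "W (U \<union> (?H - U)) = W U + W (?H - U)"
    by (intro set_integral_Un wi) auto
  moreover have "U \<union> (?H - U) = ?H" using U by auto
  ultimately have eq: "W ?H = W U + W (?H - U)" by simp
  have mD: "measure lebesgue (?H - U) = l ^ CARD('n) - measure lebesgue U"
    using l H U Um measurable_measure_Diff[OF H U(1) U(2)] measure_hcube[of l a] by simp
  have "c / 2 * W ?H = c * avg w ?H * (l ^ CARD('n) / 2)"
    using avg_w[OF l, of a] by simp
  also have "\<dots> \<le> c * avg w ?H * measure lebesgue (?H - U)"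
    using U(3) c_pos avg_w_nonneg[of ?H] unfolding mD by (intro mult_left_mono) auto
  also have "\<dots> = (LINT x:?H - U|lebesgue. c * avg w ?H)"
    using D by (subst set_integral_const_lmeasurable) auto
  also have "\<dots> \<le> W (?H - U)"
    using w_lower[OF l, of a] D by (intro set_integral_mono_AE set_integrable_const wi) auto
  finally show ?thesis using eq by (simp add: algebra_simps)
qed

text \<open>4 L / c is the solution of X = 2 L + (1 - c/2) X, so the bound reproduces itself. Strong
  induction on k supplies the hypothesis of \<open>stopping\<close> about smaller depths.\<close>

lemma oscint_le_dosc:
  assumes "0 < l"
  shows "oscint f (hcube a l) \<le> 4 * L / c * W (hcube a l) + dosc k f a l"
  using assms
proof (induction k arbitrary: a l rule: less_induct)
  case (less k)
  let ?H = "hcube a l" and ?n = "CARD('n)" and ?X = "4 * L / c"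
  let ?E = "big (avg f ?H) (L * avg w ?H) a l"
  have X: "0 \<le> ?X" using L_nonneg c_pos by simp
  have E: "measure lebesgue ?E \<le> l ^ ?n / 2 ^ (?n + 2)"
    using weak_type[OF less.prems] by (simp add: big_def)
  also have "\<dots> \<le> l ^ ?n / 2 ^ (?n + 1)" using less.prems by (intro divide_left_mono) auto
  finally obtain U where U: "U \<in> sets lebesgue" "U \<subseteq> ?H" "measure lebesgue U \<le> 2 ^ (?n + 1) * measure lebesgue ?E"
    "oscint f ?H \<le> L * W ?H + L * avg w ?H * l ^ ?n + ?X * W U + dosc k f a l"
    using stopping[OF X, of k k l "avg f ?H" "L * avg w ?H" a] less unfolding oscint_def by auto
  \<comment> \<open>The charge factor 2^(n+1) against the weak-type constant 2^-(n+2) leaves one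
    half.\<close>
  have "2 ^ (?n + 1) * measure lebesgue ?E \<le> 2 ^ (?n + 1) * (l ^ ?n / 2 ^ (?n + 2))"
    by (intro mult_left_mono E) auto
  also have "\<dots> = l ^ ?n / 2" by (simp add: power_add)
  finally have "W U \<le> (1 - c / 2) * W ?H" using U less.prems by (intro W_half_le) auto
  then have "?X * W U \<le> ?X * ((1 - c / 2) * W ?H)" by (intro mult_left_mono X)
  also have "\<dots> = ?X * W ?H - 2 * L * W ?H" using c_pos by (simp add: field_simps)
  finally have "oscint f ?H \<le> L * W ?H + L * (avg w ?H * l ^ ?n) + (?X * W ?H - 2 * L * W ?H) + dosc k f a l"
    using U(4) by (simp add: mult.assoc)
  then show ?case unfolding avg_w[OF less.prems] by simp
qed

text \<open>Only the error term in \<open>oscint_le_dosc\<close> depends on k, and it can be made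
  arbitrarily small.\<close>

lemma oscint_le_weight:
  assumes "0 < l"
  shows "oscint f (hcube a l) \<le> 4 * L / c * W (hcube a l)"
proof (rule field_le_epsilon)
  fix e :: real assume "0 < e"
  then obtain k where "dosc k f a l \<le> e" using dosc_arbitrarily_small f_int assms by blast
  with oscint_le_dosc[OF assms, of a k] show "oscint f (hcube a l) \<le> 4 * L / c * W (hcube a l) + e"
    by simp
qed

end

subsection \<open>Weights and the norms\<close>

lemma nn_set_integral_eq_ennreal:
  assumes "set_integrable M S g" "\<And>x. 0 \<le> g x"
  shows "(\<integral>\<^sup>+x\<in>S. ennreal (g x) \<partial>M) = ennreal (LINT x:S|M. g x)"
proof -
  have "(\<integral>\<^sup>+x\<in>S. ennreal (g x) \<partial>M) = (\<integral>\<^sup>+x. ennreal (indicator S x *\<^sub>R g x) \<partial>M)"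
    by (intro nn_integral_cong) (auto split: split_indicator)
  also have "\<dots> = ennreal (LINT x:S|M. g x)"
    unfolding set_lebesgue_integral_def
    using assms by (intro nn_integral_eq_integral) (auto simp: set_integrable_def)
  finally show ?thesis .
qed

lemma locally_integrable_cbox:
  assumes "locally_integrable f"
  shows "set_integrable lebesgue (cbox a b) f"
  using assms by (auto simp: locally_integrable_def)

lemma locally_integrable_hcube:
  assumes "locally_integrable f"
  shows "set_integrable lebesgue (hcube a l) f"
  by (rule set_integrable_subset[OF locally_integrable_cbox[OF assms, of a "a + vec l"]]) (auto simp: hcube_subset_cbox)

lemma set_integral_cbox_eq_hcube:
  assumes "locally_integrable f"
  shows "(LINT x:cbox a (a + vec l)|lebesgue. f x) = (LINT x:hcube a l|lebesgue. f x)"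
proof (rule set_integral_cong_set)
  show "set_borel_measurable lebesgue (hcube a l) f" "set_borel_measurable lebesgue (cbox a (a + vec l)) f"
    using locally_integrable_hcube[OF assms] locally_integrable_cbox[OF assms]
    by (auto simp: set_integrable_def set_borel_measurable_def)
  show "AE x in lebesgue. x \<in> hcube a l \<longleftrightarrow> x \<in> cbox a (a + vec l)"
    using AE_cbox_iff_hcube[of a l] by eventually_elim simp
qed

lemma avg_cbox_eq_hcube:
  assumes "locally_integrable f"
  shows "avg f (cbox a (a + vec l)) = avg f (hcube a l)"
proof -
  have "measure lebesgue (cbox a (a + vec l)) = measure lebesgue (hcube a l)"
    using AE_cbox_iff_hcube[of a l] by (intro measure_eq_AE) auto
  then show ?thesis by (simp only: avg_def set_integral_cbox_eq_hcube[OF assms])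
qed

lemma nn_integral_cbox_eq_hcube:
  "(\<integral>\<^sup>+x\<in>cbox a (a + vec l). g x \<partial>lebesgue) = (\<integral>\<^sup>+x\<in>hcube a l. g x \<partial>lebesgue)"
proof (rule nn_integral_cong_AE)
  show "AE x in lebesgue. g x * indicator (cbox a (a + vec l)) x = g x * indicator (hcube a l) x"
    using AE_cbox_iff_hcube[of a l] by eventually_elim (simp add: indicator_def)
qed

text \<open>Moving the outer power to the bound removes \<open>ennpowr\<close> from the later
  estimates. An infinite x fails both inequalities.\<close>

lemma ennpowr_inverse_le_iff:
  assumes "0 < p" "0 \<le> M"
  shows "ennpowr x (1 / p) \<le> ennreal M \<longleftrightarrow> x \<le> ennreal (M powr p)"
proof (cases x)
  case (real r)
  have "r powr (1 / p) \<le> M \<longleftrightarrow> r \<le> M powr p"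
  proof
    assume "r powr (1 / p) \<le> M"
    then have "(r powr (1 / p)) powr p \<le> M powr p" using assms by (intro powr_mono2) auto
    then show "r \<le> M powr p" using assms real by (simp add: powr_powr)
  next
    assume "r \<le> M powr p"
    then have "r powr (1 / p) \<le> (M powr p) powr (1 / p)" using assms real by (intro powr_mono2) auto
    then show "r powr (1 / p) \<le> M" using assms by (simp add: powr_powr)
  qed
  then show ?thesis using assms real by (simp add: ennpowr_def)
qed (simp add: ennpowr_def top_unique)

lemma ennreal_divide_le_iff:
  assumes "0 < (v::real)" "0 \<le> K"
  shows "x / ennreal v \<le> ennreal K \<longleftrightarrow> x \<le> ennreal (K * v)"
  using assms by (cases x) (auto simp: divide_ennreal divide_le_eq ennreal_top_divide top_unique)

section \<open>Consequences of the A_1 condition\<close>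

lemma A1_lower_bound:
  fixes w :: "real^'n \<Rightarrow> real"
  assumes "w \<in> A1"
  obtains c where "0 < c"
    "\<And>a l. 0 < l \<Longrightarrow> AE x in lebesgue. x \<in> hcube a l \<longrightarrow> c * avg w (hcube a l) \<le> w x"
proof -
  have w: "locally_integrable w" "\<And>x. 0 \<le> w x" and fin: "A1_const w < \<infinity>"
    using assms by (auto simp: A1_def weight_def)
  obtain K where K: "A1_const w = ennreal K" "0 \<le> K" using fin by (cases "A1_const w") auto
  \<comment> \<open>K is only known to be nonnegative, so c = 1 / (K + 1) is taken instead of 1 /
    K.\<close>
  have "AE x in lebesgue. x \<in> hcube a l \<longrightarrow> 1 / (K + 1) * avg w (hcube a l) \<le> w x" if l: "0 < l" for a l
  proof -
    let ?Q = "cbox a (a + vec l)" and ?i = "\<lambda>x. inverse (ennreal (w x))"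
    have bound: "ennreal (avg w ?Q) * esssup (lebesgue_on ?Q) ?i \<le> ennreal K"
      unfolding K(1)[symmetric] A1_const_def by (rule SUP_upper) (use l in \<open>auto simp: cubes_def\<close>)
    have "AE x in lebesgue_on ?Q. ?i x \<le> esssup (lebesgue_on ?Q) ?i" by (rule esssup_AE)
    then have "AE x in lebesgue. x \<in> ?Q \<longrightarrow> ?i x \<le> esssup (lebesgue_on ?Q) ?i"
      by (subst (asm) AE_restrict_space_iff) auto
    then show ?thesis
    proof eventually_elim
      case (elim x)
      show ?case
      proof
        assume "x \<in> hcube a l"
        with elim hcube_subset_cbox[of a l] have "?i x \<le> esssup (lebesgue_on ?Q) ?i" by blast
        then have "ennreal (avg w ?Q) * ?i x \<le> ennreal K"
          using bound by (meson mult_left_mono order_trans zero_le)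
        then have "ennreal (avg w (hcube a l)) * ?i x \<le> ennreal K" by (simp only: avg_cbox_eq_hcube[OF w(1)])
        moreover have nn: "0 \<le> avg w (hcube a l)"
          unfolding avg_def set_lebesgue_integral_def
          by (auto intro!: mult_nonneg_nonneg integral_nonneg_AE simp: w(2))
        ultimately have "avg w (hcube a l) \<le> K * w x"
        proof (cases "w x = 0")
          \<comment> \<open>Where w vanishes the inverse is infinite, and the finite bound forces
            the mean to be 0.\<close>
          case True
          with \<open>ennreal (avg w (hcube a l)) * ?i x \<le> ennreal K\<close> have "ennreal (avg w (hcube a l)) = 0"
            by (auto simp: ennreal_mult_top top_unique split: if_splits)
          with nn True show ?thesis by simp
        next
          case False
          then have "0 < w x" using w(2)[of x] by simp
          with \<open>ennreal (avg w (hcube a l)) * ?i x \<le> ennreal K\<close> nn K(2) show ?thesis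
            by (simp add: inverse_ennreal ennreal_mult[symmetric] field_simps)
        qed
        also have "\<dots> \<le> (K + 1) * w x" using w(2)[of x] by (simp add: algebra_simps)
        finally show "1 / (K + 1) * avg w (hcube a l) \<le> w x"
          using K(2) by (simp add: pos_divide_le_eq mult.commute)
      qed
    qed
  qed
  moreover have "0 < 1 / (K + 1)" using K(2) by simp
  ultimately show ?thesis using that by blast
qed

text \<open>Suppose that w has integral 0 over one cube. The lower bound attached to a larger cube
  holds on the small one too, so it forces the mean over the larger cube to be 0. Enlarging the cube
  exhausts the space and contradicts \<open>weight\<close>.\<close>

lemma A1_integral_pos:
  fixes w :: "real^'n \<Rightarrow> real"
  assumes w: "w \<in> A1" and l: "0 < l"
  shows "0 < (LINT x:hcube a l|lebesgue. w x)"
proof (rule ccontr)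
  have li: "locally_integrable w" "\<And>x. 0 \<le> w x" and nz: "\<not> (AE x in lebesgue. w x = 0)"
    using w by (auto simp: A1_def weight_def)
  have nonneg: "0 \<le> (LINT x:S|lebesgue. w x)" for S
    unfolding set_lebesgue_integral_def by (intro integral_nonneg_AE) (auto simp: li)
  assume "\<not> 0 < (LINT x:hcube a l|lebesgue. w x)"
  with nonneg[of "hcube a l"] have 0: "(LINT x:hcube a l|lebesgue. w x) = 0" by simp
  obtain c where c: "0 < c"
    "\<And>a l. 0 < l \<Longrightarrow> AE x in lebesgue. x \<in> hcube a l \<longrightarrow> c * avg w (hcube a l) \<le> w x"
    using A1_lower_bound[OF w] by blast
  \<comment> \<open>The enlargements are concentric with integer N, so only countably many null sets
    are united.\<close>
  have "AE x in lebesgue. \<forall>N::nat. x \<in> hcube (a - vec (real N)) (l + 2 * real N) \<longrightarrow> w x = 0"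
    unfolding AE_all_countable
  proof
    fix N :: nat
    let ?l = "l + 2 * real N"
    let ?C = "hcube (a - vec (real N)) ?l" and ?H = "hcube a l"
    have L: "0 < ?l" using l by simp
    have sub: "?H \<subseteq> ?C"
    proof
      fix x assume "x \<in> ?H"
      then have "a $ i \<le> x $ i" "x $ i < a $ i + l" for i by (auto simp: hcube_def)
      then have "a $ i - real N \<le> x $ i" "x $ i < a $ i - real N + ?l" for i
        by (smt (verit) of_nat_0_le_iff)+
      then show "x \<in> ?C" by (simp add: hcube_def)
    qed
    have "measure lebesgue ?H * (c * avg w ?C) = (LINT x:?H|lebesgue. c * avg w ?C)"
      using l by (subst set_integral_const_lmeasurable) (auto intro: lmeasurable_hcube)
    also have "\<dots> \<le> (LINT x:?H|lebesgue. w x)"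
      using c(2)[OF L, of "a - vec (real N)"] sub l
      by (intro set_integral_mono_AE set_integrable_const lmeasurable_hcube locally_integrable_hcube li) auto
    also have "\<dots> = 0" by (rule 0)
    finally have "measure lebesgue ?H * (c * avg w ?C) \<le> 0" .
    moreover have "0 < measure lebesgue ?H" using l by (subst measure_hcube) auto
    ultimately have "avg w ?C \<le> 0" using c(1) by (simp add: mult_le_0_iff)
    moreover have "0 < measure lebesgue ?C" using L by (subst measure_hcube) auto
    ultimately have "(LINT x:?C|lebesgue. w x) \<le> 0"
      by (simp add: avg_def divide_le_0_iff)
    with nonneg[of ?C] have "(LINT x:?C|lebesgue. w x) = 0" by simp
    then have "AE x in lebesgue. indicator ?C x *\<^sub>R w x = 0"
      unfolding set_lebesgue_integral_def
      by (subst (asm) integral_nonneg_eq_0_iff_AE)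
        (use locally_integrable_hcube[OF li(1)] in \<open>auto simp: set_integrable_def li\<close>)
    then show "AE x in lebesgue. x \<in> ?C \<longrightarrow> w x = 0"
      by eventually_elim (auto split: split_indicator)
  qed
  then have "AE x in lebesgue. w x = 0"
  proof eventually_elim
    case (elim x)
    obtain N :: nat where N: "norm (x - a) < real N" using reals_Archimedean2 by blast
    have "x \<in> hcube (a - vec (real N)) (l + 2 * real N)"
      unfolding hcube_def
    proof (intro CollectI allI)
      fix i
      have "\<bar>(x - a) $ i\<bar> \<le> norm (x - a)" by (rule component_le_norm_cart)
      then have "\<bar>x $ i - a $ i\<bar> < real N" using N by simp
      then have "a $ i - real N \<le> x $ i \<and> x $ i < a $ i - real N + (l + 2 * real N)"
        using l by linarith
      then show "(a - vec (real N)) $ i \<le> x $ i \<and> x $ i < (a - vec (real N)) $ i + (l + 2 * real N)"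
        by simp
    qed
    with elim show ?case by blast
  qed
  with nz show False by blast
qed

text \<open>Positivity of w(Q) clears the denominator and monotonicity of powers moves 1/p across,
  which leaves one integral inequality per half-open cube.\<close>

lemma BMO_norm_le_iff:
  fixes f :: "real^'n \<Rightarrow> 'b::euclidean_space"
  assumes w: "w \<in> A1" and f: "locally_integrable f" and p: "0 < p" and M: "0 \<le> M"
  shows "BMO_norm p w f \<le> ennreal M \<longleftrightarrow>
    (\<forall>a l. 0 < l \<longrightarrow>
      (\<integral>\<^sup>+y\<in>hcube a l. ennreal (norm (f y - avg f (hcube a l)) powr p * w y powr (1 - p)) \<partial>lebesgue)
        \<le> ennreal (M powr p * (LINT x:hcube a l|lebesgue. w x)))"
proof -
  have li: "locally_integrable w" using w by (simp add: A1_def weight_def)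
  have cubes: "(\<forall>Q\<in>cubes. P Q) \<longleftrightarrow> (\<forall>a l. 0 < l \<longrightarrow> P (cbox a (a + vec l)))" for P :: "(real^'n) set \<Rightarrow> bool"
    by (auto simp: cubes_def)
  have "BMO_norm p w f \<le> ennreal M \<longleftrightarrow> (\<forall>a l. 0 < l \<longrightarrow>
    ennpowr ((\<integral>\<^sup>+y\<in>hcube a l. ennreal (norm (f y - avg f (hcube a l)) powr p * w y powr (1 - p)) \<partial>lebesgue)
         / ennreal (LINT x:hcube a l|lebesgue. w x)) (1 / p) \<le> ennreal M)"
    unfolding BMO_norm_def SUP_le_iff cubes avg_cbox_eq_hcube[OF f] nn_integral_cbox_eq_hcube
      set_integral_cbox_eq_hcube[OF li] by (rule refl)
  then show ?thesis
    using p M A1_integral_pos[OF w] by (simp add: ennpowr_inverse_le_iff ennreal_divide_le_iff)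
qed

lemma A1_AE_pos:
  fixes w :: "real^'n \<Rightarrow> real"
  assumes w: "w \<in> A1" and l: "0 < l"
  shows "AE x in lebesgue. x \<in> hcube a l \<longrightarrow> 0 < w x"
proof -
  obtain c where c: "0 < c"
    "\<And>a l. 0 < l \<Longrightarrow> AE x in lebesgue. x \<in> hcube a l \<longrightarrow> c * avg w (hcube a l) \<le> w x"
    using A1_lower_bound[OF w] by blast
  have m: "0 < measure lebesgue (hcube a l)" using l by (subst measure_hcube) auto
  have "0 < avg w (hcube a l)"
    unfolding avg_def real_scaleR_def using m A1_integral_pos[OF w l, of a]
    by (intro mult_pos_pos divide_pos_pos zero_less_one)
  then have "0 < c * avg w (hcube a l)" by (rule mult_pos_pos[OF c(1)])
  with c(2)[OF l, of a] show ?thesis by (auto elim!: eventually_mono)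
qed

text \<open>Since \<open>0 powr 0 = 0\<close>, the factor with exponent 1 - 1 equals 1 only where w
  > 0; by \<open>A1_AE_pos\<close> this is almost everywhere on the cube.\<close>

lemma nn_integral_oscillation_eq_oscint:
  fixes f :: "real^'n \<Rightarrow> 'b::euclidean_space"
  assumes w: "w \<in> A1" and f: "locally_integrable f" and l: "0 < l"
  shows "(\<integral>\<^sup>+y\<in>hcube a l. ennreal (norm (f y - avg f (hcube a l)) powr 1 * w y powr (1 - 1)) \<partial>lebesgue)
    = ennreal (oscint f (hcube a l))"
proof -
  have "(\<integral>\<^sup>+y\<in>hcube a l. ennreal (norm (f y - avg f (hcube a l)) powr 1 * w y powr (1 - 1)) \<partial>lebesgue)
    = (\<integral>\<^sup>+y\<in>hcube a l. ennreal (norm (f y - avg f (hcube a l))) \<partial>lebesgue)"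
    using A1_AE_pos[OF w l, of a]
    by (intro nn_integral_cong_AE) (auto elim!: eventually_mono split: split_indicator)
  also have "\<dots> = ennreal (oscint f (hcube a l))"
    unfolding oscint_def using l
    by (intro nn_set_integral_eq_ennreal set_integrable_norm_diff_const lmeasurable_hcube locally_integrable_hcube f) auto
  finally show ?thesis .
qed

lemma BMO_norm_1_le_iff:
  fixes f :: "real^'n \<Rightarrow> 'b::euclidean_space"
  assumes w: "w \<in> A1" and f: "locally_integrable f" and M: "0 \<le> M"
  shows "BMO_norm 1 w f \<le> ennreal M \<longleftrightarrow>
    (\<forall>a l. 0 < l \<longrightarrow> oscint f (hcube a l) \<le> M * (LINT x:hcube a l|lebesgue. w x))"
proof -
  have "ennreal (oscint f (hcube a l)) \<le> ennreal (M powr 1 * (LINT x:hcube a l|lebesgue. w x))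
    \<longleftrightarrow> oscint f (hcube a l) \<le> M * (LINT x:hcube a l|lebesgue. w x)" if "0 < l" for a l
    using M A1_integral_pos[OF w that, of a] by simp
  then show ?thesis
    unfolding BMO_norm_le_iff[OF w f zero_less_one M]
    by (simp only: nn_integral_oscillation_eq_oscint[OF w f] cong: imp_cong)
qed

section \<open>The two comparisons of the norms\<close>

lemma ennreal_le_cmult_if_real_bounds:
  fixes x y :: ennreal and C :: real
  assumes C: "0 < C" and bound: "\<And>M. 0 < M \<Longrightarrow> x \<le> ennreal M \<Longrightarrow> y \<le> ennreal (C * M)"
  shows "y \<le> ennreal C * x"
proof (cases x)
  case (real m)
  show ?thesis
  proof (rule ennreal_le_epsilon)
    fix e :: real assume e: "0 < e"
    \<comment> \<open>The added e / C keeps the tested bound positive even when x = 0, and it costs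
      exactly e.\<close>
    have "y \<le> ennreal (C * (m + e / C))"
      using real C e by (intro bound) (auto intro!: ennreal_leI add_nonneg_pos)
    also have "\<dots> = ennreal C * x + ennreal e"
      using real C e by (simp add: distrib_left ennreal_mult)
    finally show "y \<le> ennreal C * x + ennreal e" .
  qed
next
  case top
  then show ?thesis using C by (simp add: ennreal_mult_top)
qed

text \<open>Young's inequality with weights r and 1 - r is applied to |f - f_Q| / M and w.
  Integrated over Q it gives at most (r + (1 - r)) w(Q), hence the constant 1.\<close>

lemma BMO_norm_le_BMO_norm_1:
  fixes f :: "real^'n \<Rightarrow> 'b::euclidean_space"
  assumes w: "w \<in> A1" and f: "locally_integrable f" and r: "0 < r" "r < 1"
  shows "BMO_norm r w f \<le> BMO_norm 1 w f"
proof -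
  have li: "locally_integrable w" "\<And>x. 0 \<le> w x" using w by (auto simp: A1_def weight_def)
  have "BMO_norm r w f \<le> ennreal 1 * BMO_norm 1 w f"
  proof (rule ennreal_le_cmult_if_real_bounds)
    fix M :: real assume M: "0 < M" and "BMO_norm 1 w f \<le> ennreal M"
    then have osc: "oscint f (hcube a l) \<le> M * (LINT x:hcube a l|lebesgue. w x)" if "0 < l" for a l
      using that by (simp add: BMO_norm_1_le_iff[OF w f])
    have "BMO_norm r w f \<le> ennreal M"
      unfolding BMO_norm_le_iff[OF w f r(1) less_imp_le[OF M]]
    proof (intro allI impI)
      fix a and l :: real assume l: "0 < l"
      let ?H = "hcube a l" and ?g = "\<lambda>y. norm (f y - avg f (hcube a l))"
      let ?h = "\<lambda>y. M powr r * (r / M) * ?g y + M powr r * (1 - r) * w y"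
      have g: "set_integrable lebesgue ?H ?g"
        using l by (intro set_integrable_norm_diff_const lmeasurable_hcube locally_integrable_hcube f) auto
      have wi: "set_integrable lebesgue ?H w" by (rule locally_integrable_hcube[OF li(1)])
      have young: "?g y powr r * w y powr (1 - r) \<le> ?h y" if "0 < w y" for y
      \<comment> \<open>Young's inequality is applied to positive numbers only; where the
        oscillation vanishes, the left side is 0.\<close>
      proof (cases "?g y = 0")
        case False
        then have "(?g y / M) powr r * w y powr (1 - r) \<le> r * (?g y / M) + (1 - r) * w y"
          using M r that by (intro Youngs_inequality_0) auto
        then have "M powr r * ((?g y / M) powr r * w y powr (1 - r)) \<le> M powr r * (r * (?g y / M) + (1 - r) * w y)"
          by (intro mult_left_mono) auto
        moreover have "M powr r * (?g y / M) powr r = ?g y powr r"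
          using M by (subst powr_mult[symmetric]) auto
        ultimately have "?g y powr r * w y powr (1 - r) \<le> M powr r * (r * (?g y / M) + (1 - r) * w y)"
          by (simp only: mult.assoc[symmetric])
        then show ?thesis by (simp add: distrib_left mult.assoc)
      qed (use r that in auto)
      have "(\<integral>\<^sup>+y\<in>?H. ennreal (?g y powr r * w y powr (1 - r)) \<partial>lebesgue) \<le> (\<integral>\<^sup>+y\<in>?H. ennreal (?h y) \<partial>lebesgue)"
        using A1_AE_pos[OF w l, of a] young
        by (intro nn_integral_mono_AE) (auto elim!: eventually_mono split: split_indicator intro!: ennreal_leI)
      also have "\<dots> = ennreal (LINT y:?H|lebesgue. ?h y)"
        using M r li(2) by (intro nn_set_integral_eq_ennreal set_integral_add set_integrable_mult_right g wi) auto
      also have "(LINT y:?H|lebesgue. ?h y) = M powr r * (r / M) * oscint f ?H + M powr r * (1 - r) * (LINT y:?H|lebesgue. w y)"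
        using g wi by (subst set_integral_add) (auto simp: oscint_def)
      also have "\<dots> \<le> M powr r * (r / M) * (M * (LINT y:?H|lebesgue. w y)) + M powr r * (1 - r) * (LINT y:?H|lebesgue. w y)"
        using osc[OF l, of a] M r by (intro add_right_mono mult_left_mono) auto
      also have "\<dots> = M powr r * (LINT y:?H|lebesgue. w y)" using M by (simp add: algebra_simps)
      finally show "(\<integral>\<^sup>+y\<in>?H. ennreal (?g y powr r * w y powr (1 - r)) \<partial>lebesgue)
        \<le> ennreal (M powr r * (LINT y:?H|lebesgue. w y))" by (simp add: ennreal_leI)
    qed
    then show "BMO_norm r w f \<le> ennreal (1 * M)" by simp
  qed simp
  then show ?thesis by simp
qed

text \<open>By the \<open>A\<^sub>1\<close> lower bound, \<open>\<omega>\<^bsup>1 - r\<^esup>\<close> is at least \<open>(c \<omega>\<^sub>Q)\<^bsup>1 - r\<^esup>\<close> on \<open>Q\<close>, so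
  Chebyshev's inequality turns the \<open>BMO\<^bsup>r\<^esup>\<close> bound into a weak-type bound.\<close>

lemma weak_oscillation_of_BMO_norm:
  fixes f :: "real^'n \<Rightarrow> 'b::euclidean_space"
  assumes w: "w \<in> A1" and f: "locally_integrable f" and r: "0 < r" "r < 1"
    and c: "0 < c" "\<And>a l. 0 < l \<Longrightarrow> AE x in lebesgue. x \<in> hcube a l \<longrightarrow> c * avg w (hcube a l) \<le> w x"
    and t: "0 < t" "t powr r * c powr (1 - r) = 2 ^ (CARD('n) + 2)"
    and M: "0 < M" "BMO_norm r w f \<le> ennreal M"
  shows "weak_oscillation f w (t * M) c"
proof
  have li: "locally_integrable w" "\<And>x. 0 \<le> w x" using w by (auto simp: A1_def weight_def)
  show "set_integrable lebesgue (hcube a l) f" "set_integrable lebesgue (hcube a l) w" for a l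
    by (intro locally_integrable_hcube f li)+
  show "0 \<le> w x" for x by (rule li)
  show "0 < c" by (rule c)
  show "0 \<le> t * M" using t M by simp
  show "AE x in lebesgue. x \<in> hcube a l \<longrightarrow> c * avg w (hcube a l) \<le> w x" if "0 < l" for a l
    by (rule c(2)[OF that])
  show "measure lebesgue {x \<in> hcube a l. t * M * avg w (hcube a l) < norm (f x - avg f (hcube a l))}
    \<le> l ^ CARD('n) / 2 ^ (CARD('n) + 2)" if l: "0 < l" for a l
  proof -
    let ?H = "hcube a l" and ?g = "\<lambda>y. norm (f y - avg f (hcube a l))"
    let ?E = "{x \<in> ?H. t * M * avg w ?H < ?g x}" and ?v = "avg w (hcube a l)"
    \<comment> \<open>This bounds the integrand from below on the exceptional set: both exponents
      are positive because 0 < r < 1, so the lower bounds for the oscillation and for w can be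
      raised to them.\<close>
    let ?k = "(t * M * ?v) powr r * (c * ?v) powr (1 - r)"
    have mH: "measure lebesgue ?H = l ^ CARD('n)" using l by (intro measure_hcube) simp
    have avg: "?v * l ^ CARD('n) = (LINT x:?H|lebesgue. w x)"
      using l by (simp add: avg_def mH)
    then have v: "0 < ?v"
      using A1_integral_pos[OF w l, of a] l by (metis zero_less_mult_pos2 zero_less_power)
    have [measurable]: "(\<lambda>x. indicator ?H x *\<^sub>R f x) \<in> borel_measurable lebesgue"
      using locally_integrable_hcube[OF f] unfolding set_integrable_def by (rule borel_measurable_integrable)
    have "?E = ?H \<inter> {x \<in> space lebesgue. t * M * ?v < norm (indicator ?H x *\<^sub>R f x - avg f ?H)}"
      by auto
    also have "\<dots> \<in> sets lebesgue" by measurable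
    finally have E: "?E \<in> sets lebesgue" .
    then have Em: "?E \<in> lmeasurable"
      by (rule fmeasurableI2[OF lmeasurable_hcube[of l a], rotated 2]) (use l in auto)
    have "ennreal ?k * emeasure lebesgue ?E = (\<integral>\<^sup>+y\<in>?E. ennreal ?k \<partial>lebesgue)"
      using E by (simp add: nn_integral_cmult_indicator)
    also have "\<dots> \<le> (\<integral>\<^sup>+y\<in>?H. ennreal (?g y powr r * w y powr (1 - r)) \<partial>lebesgue)"
    proof (rule nn_integral_mono_AE)
      show "AE y in lebesgue. ennreal ?k * indicator ?E y \<le> ennreal (?g y powr r * w y powr (1 - r)) * indicator ?H y"
        using c(2)[OF l, of a]
      proof eventually_elim
        case (elim y)
        have "?k \<le> ?g y powr r * w y powr (1 - r)" if "y \<in> ?E"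
          using that elim r t M c(1) v
          by (intro mult_mono powr_mono2) (auto intro!: mult_nonneg_nonneg)
        then show ?case by (auto split: split_indicator intro!: ennreal_leI)
      qed
    qed
    also have "\<dots> \<le> ennreal (M powr r * (LINT x:?H|lebesgue. w x))"
      using M(2) l unfolding BMO_norm_le_iff[OF w f r(1) less_imp_le[OF M(1)]] by blast
    finally have "ennreal (?k * measure lebesgue ?E) \<le> ennreal (M powr r * (?v * l ^ CARD('n)))"
      unfolding avg using Em by (simp add: ennreal_mult emeasure_eq_measure2)
    then have le: "?k * measure lebesgue ?E \<le> M powr r * (?v * l ^ CARD('n))"
      using v l by (subst (asm) ennreal_le_iff) auto
    \<comment> \<open>The powers of w_Q combine to exponent 1, so w_Q and M^r cancel later, and the
      choice of t leaves exactly l^n / 2^(n+2).\<close>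
    have k: "?k = M powr r * ?v * (t powr r * c powr (1 - r))"
    proof -
      have "?v powr r * ?v powr (1 - r) = ?v" using v by (simp flip: powr_add)
      then show ?thesis using t M c(1) v by (simp add: powr_mult mult_ac)
    qed
    from le have "M powr r * ?v * (2 ^ (CARD('n) + 2) * measure lebesgue ?E) \<le> M powr r * ?v * l ^ CARD('n)"
      unfolding k t(2) by (simp only: mult.assoc)
    then have "2 ^ (CARD('n) + 2) * measure lebesgue ?E \<le> l ^ CARD('n)"
      using M(1) v by (subst (asm) mult_le_cancel_left_pos) auto
    then show ?thesis by (simp add: pos_le_divide_eq mult.commute)
  qed
qed

text \<open>The weak-type height is L = t M with t depending only on n, r and c. Hence 4 L / c is
  linear in M, and one constant serves all f.\<close>

lemma BMO_norm_1_le_BMO_norm: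
  fixes w :: "real^'n \<Rightarrow> real"
  assumes w: "w \<in> A1" and r: "0 < r" "r < 1"
  obtains C where "0 < C"
    "\<And>f :: real^'n \<Rightarrow> 'b::euclidean_space. locally_integrable f \<Longrightarrow> BMO_norm 1 w f \<le> ennreal C * BMO_norm r w f"
proof -
  obtain c where c: "0 < c"
    "\<And>a l. 0 < l \<Longrightarrow> AE x in lebesgue. x \<in> hcube a l \<longrightarrow> c * avg w (hcube a l) \<le> w x"
    using A1_lower_bound[OF w] by blast
  \<comment> \<open>The solution of t^r c^(1-r) = 2^(n+2), the factor demanded by the weak-type
    bound.\<close>
  define t where "t = (2 ^ (CARD('n) + 2) / c powr (1 - r)) powr (1 / r)"
  have t: "0 < t" "t powr r * c powr (1 - r) = 2 ^ (CARD('n) + 2)"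
    using c(1) r by (auto simp: t_def powr_powr)
  have "BMO_norm 1 w f \<le> ennreal (4 * t / c) * BMO_norm r w f"
    if f: "locally_integrable f" for f :: "real^'n \<Rightarrow> 'b"
  proof (rule ennreal_le_cmult_if_real_bounds)
    fix M :: real assume M: "0 < M" "BMO_norm r w f \<le> ennreal M"
    interpret weak_oscillation f w "t * M" c
      by (rule weak_oscillation_of_BMO_norm[OF w f r c t M])
    have "oscint f (hcube a l) \<le> 4 * t / c * M * (LINT x:hcube a l|lebesgue. w x)" if "0 < l" for a l
      using oscint_le_weight[OF that, of a] by (simp add: mult.assoc)
    then show "BMO_norm 1 w f \<le> ennreal (4 * t / c * M)"
      using M t c(1) by (simp add: BMO_norm_1_le_iff[OF w f])
  qed (use t c(1) in simp)
  moreover have "0 < 4 * t / c" using t c(1) by simp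
  ultimately show ?thesis using that by blast
qed

(* The sort of 'b covers both real-valued and complex-valued functions. *)
theorem theorem1p2:
  fixes \<omega> :: "real^'n \<Rightarrow> real" and r :: real
  assumes "\<omega> \<in> A1" and "0 < r" and "r < 1"
  shows "(BMO \<omega> :: (real^'n \<Rightarrow> 'b::{real_normed_field, euclidean_space}) set) = BMOp r \<omega> \<and>
    (\<exists>C::real. C \<ge> 1 \<and> (\<forall>f \<in> (BMO \<omega> :: (real^'n \<Rightarrow> 'b) set).
        ennreal (inverse C) * BMO_norm 1 \<omega> f \<le> BMO_norm r \<omega> f \<and>
        BMO_norm r \<omega> f \<le> ennreal C * BMO_norm 1 \<omega> f))"
proof -
  obtain C where C: "0 < C"
    "\<And>f :: real^'n \<Rightarrow> 'b. locally_integrable f \<Longrightarrow> BMO_norm 1 \<omega> f \<le> ennreal C * BMO_norm r \<omega> f"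
    using BMO_norm_1_le_BMO_norm[OF assms] by blast
  note le = BMO_norm_le_BMO_norm_1[OF assms(1) _ assms(2,3)]
  \<comment> \<open>Each norm is at most a finite multiple of the other, so finiteness passes in
    both directions and the two sets coincide.\<close>
  have "BMO_norm r \<omega> f < \<infinity> \<longleftrightarrow> BMO_norm 1 \<omega> f < \<infinity>"
    if "locally_integrable f" for f :: "real^'n \<Rightarrow> 'b"
  proof
    assume "BMO_norm r \<omega> f < \<infinity>"
    then have "ennreal C * BMO_norm r \<omega> f < \<infinity>" by (simp add: ennreal_mult_less_top)
    with C(2)[OF that] show "BMO_norm 1 \<omega> f < \<infinity>" by (rule order.strict_trans1)
  qed (use le[OF that] in \<open>rule order.strict_trans1\<close>)
  then have eq: "(BMO \<omega> :: (real^'n \<Rightarrow> 'b) set) = BMOp r \<omega>" by (auto simp: BMOp_def)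
  \<comment> \<open>The maximum secures K >= 1. The bound of the r-norm already holds with constant
    1 and survives the enlargement.\<close>
  define K where "K = max 1 C"
  have K: "1 \<le> K" "C \<le> K" by (auto simp: K_def)
  have "ennreal (inverse K) * BMO_norm 1 \<omega> f \<le> BMO_norm r \<omega> f \<and> BMO_norm r \<omega> f \<le> ennreal K * BMO_norm 1 \<omega> f"
    if "f \<in> BMO \<omega>" for f :: "real^'n \<Rightarrow> 'b"
  proof
    have f: "locally_integrable f" using that by (simp add: BMOp_def)
    have "BMO_norm 1 \<omega> f \<le> ennreal K * BMO_norm r \<omega> f"
      using C(2)[OF f] K(2) by (meson ennreal_leI mult_right_mono order_trans zero_le)
    then have "ennreal (inverse K) * BMO_norm 1 \<omega> f \<le> ennreal (inverse K) * (ennreal K * BMO_norm r \<omega> f)"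
      by (intro mult_left_mono) auto
    also have "\<dots> = BMO_norm r \<omega> f"
      using K(1) by (simp flip: mult.assoc ennreal_mult)
    finally show "ennreal (inverse K) * BMO_norm 1 \<omega> f \<le> BMO_norm r \<omega> f" .
    have "BMO_norm r \<omega> f \<le> 1 * BMO_norm 1 \<omega> f" using le[OF f] by simp
    also have "\<dots> \<le> ennreal K * BMO_norm 1 \<omega> f" using K(1) by (intro mult_right_mono) auto
    finally show "BMO_norm r \<omega> f \<le> ennreal K * BMO_norm 1 \<omega> f" .
  qed
  with eq K(1) show ?thesis by blast
qed

end
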